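(* Let $F=\frac1n\sum_{i=1}^nF_i$ with each $F_i:\mathbb{R}^d\to\mathbb{R}^d$ $L$-Lipschitz and monotone. Suppose there exists a compact subset $\mathcal C\subseteq\mathbb{R}^d$ containing a zero $x_*$ of $F$ such that $x_k,\hat x_k\in\mathcal C$ for all $k\ge1$ during the runtime of DecPolyakSEG. Then $\overline x_K=\frac1{K+1}\sum_{k=0}^Kx_k$ generated by DecPolyakSEG with $c_k=\sqrt{k+1}$ satisfies, for any $u\in\mathcal C$, $$\mathbb{E}\left[\langle F(u),\overline x_K-u\rangle\right]\le\frac1{K+1}\,\mathbb{E}\left[\frac{D^2}{\gamma_{K+1}}\right]+\frac{\sigma^2\gamma_0}{(1-A)(K+1)}\sum_{k=0}^K\frac1{\sqrt{k+1}},$$ where $\sigma^2:=2L^2\max_{u_1,u_2\in\mathcal C}\|u_1-u_2\|^2+2\,\mathbb{E}\left[\|F_{\mathcal S}(x_* )\|^2\right]$.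
   Context: For a minibatch $\mathcal S\subseteq\{1,\dots,n\}$ of size $B$, $F_{\mathcal S}(x):=\frac1B\sum_{i\in\mathcal S}F_i(x)$; the $\mathcal S_k$ are random subsets of size $B$ sampled independently at each iteration $k$, and $F_{\mathcal S_k}(x)$ is an unbiased estimator of $F(x)$; $\mathcal S$ denotes a generic such sample. DecPolyakSEG: given an initial point $x_0\in\mathbb{R}^d$, a positive sequence $\{\gamma_k\}_{k\ge0}$, $\omega_{-1}=\infty$ and a non-decreasing sequence $\{c_k\}_{k\ge0}$, for $k=0,1,\dots$: sample $\mathcal S_k$; ensure that $\gamma_k\le\frac{c_{k-1}}{c_k}\gamma_{k-1}$ (for $k\ge1$) and that the critical condition with parameter $A\in(0,1)$, $$\|F_{\mathcal S_k}(\hat x_k)-F_{\mathcal S_k}(x_k)\|\le A\|F_{\mathcal S_k}(x_k)\|\qquad\text{for }\hat x_k=x_k-\gamma_kF_{\mathcal S_k}(x_k),$$ holds; with this $\hat x_k$ set $$\omega_k=\min\left\{\frac{\langle F_{\mathcal S_k}(\hat x_k),x_k-\hat x_k\rangle}{\|F_{\mathcal S_k}(\hat x_k)\|^2},\ \omega_{k-1}\right\},\qquad x_{k+1}=x_k-\omega_kF_{\mathcal S_k}(\hat x_k).$$ $D$ is a constant bounding the distance of the iterates from the points of $\mathcal C$: $\|x_k-u\|^2\le D^2$ for the iterates $x_k$, $k\ge0$, and $u\in\mathcal C$. Monotone: $\langle F_i(x)-F_i(y),x-y\rangle\ge0$ for all $x,y\in\mathbb{R}^d$. *)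

theory Defs
  imports "HOL-Probability.Probability"
begin

definition minibatches :: "nat \<Rightarrow> nat \<Rightarrow> nat set set" where
  "minibatches n B = {s. s \<subseteq> {1..n} \<and> card s = B}"

text \<open>Average of the operators \<open>F i\<close> over an index set. For \<open>s \<in> minibatches n B\<close> this is
  \<open>F\<^sub>S = 1/B \<Sum>i\<in>S. F i\<close>, and for \<open>s = {1..n}\<close> it is the full operator.\<close>

definition batch_mean :: "(nat \<Rightarrow> 'a \<Rightarrow> 'a) \<Rightarrow> nat set \<Rightarrow> 'a \<Rightarrow> 'a::real_vector" where
  "batch_mean F s x = (1 / real (card s)) *\<^sub>R (\<Sum>i\<in>s. F i x)"

definition monotone_operator :: "('a \<Rightarrow> 'a::real_inner) \<Rightarrow> bool" where
  "monotone_operator G \<longleftrightarrow> (\<forall>x y. 0 \<le> inner (G x - G y) (x - y))"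

definition extrapolate :: "('a \<Rightarrow> 'a) \<Rightarrow> real \<Rightarrow> 'a \<Rightarrow> 'a::real_vector" where
  "extrapolate G g x = x - g *\<^sub>R G x"

text \<open>The Polyak quotient is \<open>0/0\<close> if \<open>G\<close> vanishes at the extrapolated point \<open>xh\<close>
  (under the critical condition with \<open>A < 1\<close>, this forces \<open>G x = 0\<close> and \<open>xh = x\<close>).
  It is read as \<open>\<infinity>\<close> then, so that the minimum keeps the previous step size; the HOL value
  \<open>0/0 = 0\<close> would instead stop the method for good.\<close>

definition polyak_quotient :: "('a \<Rightarrow> 'a) \<Rightarrow> 'a \<Rightarrow> 'a::real_inner \<Rightarrow> ereal" where
  "polyak_quotient G x xh =
     (if G xh = 0 then \<infinity> else ereal (inner (G xh) (x - xh) / (norm (G xh))\<^sup>2))"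

text \<open>State before iteration \<open>k\<close> along one realisation of the minibatches \<open>s\<close> and the step
  sizes \<open>g\<close>: the pair of \<open>x\<^sub>k\<close> and \<open>\<omega>\<close> with index \<open>k - 1\<close>. The step size \<open>w'\<close> can be
  infinite only if \<open>G xh = 0\<close>, where the value of \<open>real_of_ereal\<close> is irrelevant.\<close>

primrec dec_polyak_seg_state ::
  "(nat \<Rightarrow> 'a \<Rightarrow> 'a) \<Rightarrow> 'a \<Rightarrow> (nat \<Rightarrow> nat set) \<Rightarrow> (nat \<Rightarrow> real) \<Rightarrow> nat \<Rightarrow> 'a::real_inner \<times> ereal"
where
  "dec_polyak_seg_state F x0 s g 0 = (x0, \<infinity>)"
| "dec_polyak_seg_state F x0 s g (Suc k) =
     (let (x, w) = dec_polyak_seg_state F x0 s g k;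
          G = batch_mean F (s k);
          xh = extrapolate G (g k) x;
          w' = min (polyak_quotient G x xh) w
      in (x - real_of_ereal w' *\<^sub>R G xh, w'))"

definition dec_polyak_seg ::
  "(nat \<Rightarrow> 'a \<Rightarrow> 'a) \<Rightarrow> 'a \<Rightarrow> (nat \<Rightarrow> nat set) \<Rightarrow> (nat \<Rightarrow> real) \<Rightarrow> nat \<Rightarrow> 'a::real_inner" where
  "dec_polyak_seg F x0 s g k = fst (dec_polyak_seg_state F x0 s g k)"

definition dec_polyak_seg_hat ::
  "(nat \<Rightarrow> 'a \<Rightarrow> 'a) \<Rightarrow> 'a \<Rightarrow> (nat \<Rightarrow> nat set) \<Rightarrow> (nat \<Rightarrow> real) \<Rightarrow> nat \<Rightarrow> 'a::real_inner" where
  "dec_polyak_seg_hat F x0 s g k =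
     extrapolate (batch_mean F (s k)) (g k) (dec_polyak_seg F x0 s g k)"

text \<open>What the method ensures about the step sizes; the last clause is the critical condition.\<close>

definition admissible_step_sizes ::
  "(nat \<Rightarrow> 'a \<Rightarrow> 'a) \<Rightarrow> 'a::real_inner \<Rightarrow> real \<Rightarrow> (nat \<Rightarrow> real) \<Rightarrow> (nat \<Rightarrow> nat set) \<Rightarrow> (nat \<Rightarrow> real) \<Rightarrow> bool"
where
  "admissible_step_sizes F x0 A c s g \<longleftrightarrow>
     (\<forall>k. 0 < g k) \<and>
     (\<forall>k\<ge>1. g k \<le> c (k - 1) / c k * g (k - 1)) \<and>
     (\<forall>k. norm (batch_mean F (s k) (dec_polyak_seg_hat F x0 s g k)
              - batch_mean F (s k) (dec_polyak_seg F x0 s g k))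
           \<le> A * norm (batch_mean F (s k) (dec_polyak_seg F x0 s g k)))"

end

theory Submission imports Defs
begin

text \<open>
  Write \<open>G\<^sub>k\<close> for the operator of the \<open>k\<close>-th minibatch and \<open>d\<^sub>k = \<parallel>x\<^sub>k - u\<parallel>\<^sup>2\<close>. Along
  every admissible realisation one iteration satisfies
  \<open>2 \<langle>G\<^sub>k u, x\<^sub>k - u\<rangle> \<le> (d\<^sub>k - d\<^sub>k\<^sub>+\<^sub>1) / \<omega>\<^sub>k + \<gamma>\<^sub>k \<parallel>G\<^sub>k u\<parallel>\<^sup>2 / (1 - A)\<close>
  (\<open>polyak_step_gap_le\<close>), where the reciprocal of an infinite step size is \<open>0\<close>. Here the Polyak quotient is exactly the bound on \<open>\<omega>\<^sub>k\<close> under which the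
  quadratic term of the step is absorbed, and the critical condition yields a negative multiple of
  \<open>\<parallel>G\<^sub>k x\<^sub>k\<parallel>\<^sup>2\<close> that absorbs the extrapolation error.

  The reciprocals \<open>1 / \<omega>\<^sub>k\<close> are nondecreasing and \<open>0 \<le> d\<^sub>k \<le> D\<^sup>2\<close>, so summation by parts bounds the
  distance terms by \<open>D\<^sup>2 / \<omega>\<^sub>K\<close>. The critical condition also gives \<open>\<omega>\<^sub>K \<ge> \<gamma>\<^sub>K / (1 + A)\<close>
  (\<open>dec_polyak_step_ge\<close>), and since \<open>1 + A \<le> 2\<close> and the \<open>\<gamma>\<^sub>k\<close> are nonincreasing, half of this sum is at
  most \<open>D\<^sup>2 / \<gamma>\<^sub>K\<^sub>+\<^sub>1\<close>. In the noise \<open>\<gamma>\<^sub>k\<close> is replaced by the deterministic bound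
  \<open>c\<^sub>0 \<gamma>\<^sub>0 / c\<^sub>k\<close>, which is \<open>\<gamma>\<^sub>0 / sqrt (k + 1)\<close> for the sequence at hand. The result is
  the pathwise inequality \<open>dec_polyak_seg_sum_gap_le\<close>.

  Only now are expectations taken. The point \<open>x\<^sub>k\<close> depends on the minibatches before time \<open>k\<close> only,
  so by independence (\<open>expectation_inner_past\<close>) and unbiasedness \<open>G\<^sub>k u\<close> may be replaced by the full
  operator at \<open>u\<close> on the left, whereas on the right \<open>\<parallel>G\<^sub>k u\<parallel>\<^sup>2\<close> is compared with its value at the zero
  by Lipschitz continuity, which gives \<open>\<sigma>\<^sup>2\<close>. There are finitely many minibatches, so every random
  variable that occurs is a simple function and integrability is automatic.
\<close>

section \<open>One extragradient step\<close>

text \<open>With \<open>a = G x\<close> and \<open>b = G xh\<close> the critical condition says that \<open>b\<close> is close to \<open>a\<close>. The first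
bound is Cauchy-Schwarz for \<open>a - b\<close>. The second comes from
\<open>2 \<langle>b, a\<rangle> = \<parallel>b\<parallel>\<^sup>2 + \<parallel>a\<parallel>\<^sup>2 - \<parallel>b - a\<parallel>\<^sup>2 \<ge> \<parallel>b\<parallel>\<^sup>2 + (1 - A\<^sup>2) \<parallel>a\<parallel>\<^sup>2\<close> together with
\<open>\<parallel>b\<parallel> \<le> (1 + A) \<parallel>a\<parallel>\<close>; its constant \<open>1 + A\<close> is what keeps the Polyak quotient above \<open>g / (1 + A)\<close>.\<close>

lemma critical_condition_inner_bounds:
  fixes a b :: "'a::real_inner"
  assumes crit: "norm (b - a) \<le> A * norm a" and A: "0 < A" "A < 1"
  shows "(1 - A) * (norm a)\<^sup>2 \<le> inner b a" and "(norm b)\<^sup>2 \<le> (1 + A) * inner b a"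
proof -
  have "inner (a - b) a \<le> norm (a - b) * norm a"
    by (rule norm_cauchy_schwarz)
  also have "\<dots> \<le> A * norm a * norm a"
    using crit by (intro mult_right_mono) (auto simp: norm_minus_commute)
  finally show "(1 - A) * (norm a)\<^sup>2 \<le> inner b a"
    by (simp add: inner_diff_left left_diff_distrib power2_eq_square mult.assoc dot_square_norm)
  have "norm b \<le> norm a + norm (b - a)"
    using norm_triangle_ineq[of a "b - a"] by simp
  also have "\<dots> \<le> (1 + A) * norm a"
    using crit by (simp add: algebra_simps)
  finally have "(norm b)\<^sup>2 \<le> ((1 + A) * norm a)\<^sup>2"
    by (intro power_mono) auto
  then have "(1 - A) * (norm b)\<^sup>2 \<le> (1 - A) * ((1 + A) * norm a)\<^sup>2"
    using A by (intro mult_left_mono) auto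
  moreover have "(norm (b - a))\<^sup>2 \<le> (A * norm a)\<^sup>2"
    using crit by (intro power_mono) auto
  then have "(1 + A) * ((norm b)\<^sup>2 + (norm a)\<^sup>2 - 2 * inner b a) \<le> (1 + A) * (A * norm a)\<^sup>2"
    using A by (intro mult_left_mono)
      (auto simp: power2_norm_eq_inner inner_diff_left inner_diff_right inner_commute)
  ultimately show "(norm b)\<^sup>2 \<le> (1 + A) * inner b a"
    by (simp add: power2_eq_square algebra_simps)
qed

text \<open>One iteration. Expanding the square of \<open>x - w G xh - u\<close> gives \<open>2 \<langle>G xh, x - u\<rangle> - w \<parallel>G xh\<parallel>\<^sup>2\<close> as
the scaled decrease of the squared distance; the cap on \<open>w\<close> by the Polyak quotient makes the quadratic
term at most \<open>\<langle>G xh, x - xh\<rangle> = g \<langle>G xh, G x\<rangle>\<close>, so that one such term is left over. Monotonicity replaces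
\<open>\<langle>G xh, xh - u\<rangle>\<close> by \<open>\<langle>G u, xh - u\<rangle>\<close>, and moving from \<open>xh\<close> back to \<open>x\<close> costs
\<open>2 g \<langle>G u, G x\<rangle>\<close>. The term that was left over is at least \<open>g (1 - A) \<parallel>G x\<parallel>\<^sup>2\<close> and pays for this
by Young's inequality, which leaves only \<open>\<parallel>G u\<parallel>\<^sup>2\<close>.

If \<open>G xh = 0\<close>, the critical condition forces \<open>G x = 0\<close>, the point does not move, and monotonicity
alone makes the left-hand side nonpositive, for any \<open>w\<close>. This case covers the iterations in which
the step size is still infinite, whose real value is \<open>0\<close>.\<close>

lemma polyak_step_gap_le:
  fixes G :: "'a \<Rightarrow> 'a::real_inner"
  assumes mono: "monotone_operator G" and g: "0 < g" and A: "0 < A" "A < 1"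
    and xh: "xh = extrapolate G g x"
    and crit: "norm (G xh - G x) \<le> A * norm (G x)"
    and w: "G xh \<noteq> 0 \<Longrightarrow> 0 < w \<and> w * (norm (G xh))\<^sup>2 \<le> inner (G xh) (x - xh)"
  shows "2 * inner (G u) (x - u)
    \<le> inverse w * ((norm (x - u))\<^sup>2 - (norm (x - w *\<^sub>R G xh - u))\<^sup>2) + g * (norm (G u))\<^sup>2 / (1 - A)"
proof (cases "G xh = 0")
  case True
  have "(1 - A) * norm (G x) \<le> 0"
    using crit True by (simp add: algebra_simps)
  then have "G x = 0"
    using A by (simp add: mult_le_0_iff)
  then have "inner (G u) (x - u) \<le> 0"
    using mono[unfolded monotone_operator_def, rule_format, of u x]
    by (simp add: inner_diff_right)
  then show ?thesis
    using True g A by (simp add: order.trans[OF _ divide_nonneg_pos])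
next
  case False
  let ?a = "G x" and ?b = "G xh" and ?v = "G u"
  from w[OF False] have w0: "0 < w" and wle: "w * (norm ?b)\<^sup>2 \<le> inner ?b (x - xh)"
    by auto
  have "(norm (x - u))\<^sup>2 - (norm (x - w *\<^sub>R ?b - u))\<^sup>2
      = w * (2 * inner ?b (x - u) - w * (norm ?b)\<^sup>2)"
    unfolding power2_norm_eq_inner
    by (simp add: algebra_simps inner_diff_left inner_diff_right inner_commute)
  then have "inverse w * ((norm (x - u))\<^sup>2 - (norm (x - w *\<^sub>R ?b - u))\<^sup>2)
      = 2 * inner ?b (x - u) - w * (norm ?b)\<^sup>2"
    using w0 by simp
  also have "\<dots> \<ge> 2 * inner ?b (xh - u) + inner ?b (x - xh)"
    using wle by (simp add: inner_diff_right)
  finally have "2 * inner ?b (xh - u) + inner ?b (x - xh)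
    \<le> inverse w * ((norm (x - u))\<^sup>2 - (norm (x - w *\<^sub>R ?b - u))\<^sup>2)" .
  moreover have "inner ?v (xh - u) \<le> inner ?b (xh - u)"
    using mono[unfolded monotone_operator_def, rule_format, of xh u]
    by (simp add: inner_diff_left)
  moreover have "inner ?v (xh - u) = inner ?v (x - u) - g * inner ?v ?a"
    "inner ?b (x - xh) = g * inner ?b ?a"
    by (simp_all add: xh extrapolate_def inner_diff_right)
  moreover have "g * (2 * inner ?v ?a - inner ?b ?a) \<le> g * ((norm ?v)\<^sup>2 / (1 - A))"
  proof (intro mult_left_mono)
    define e where "e = 1 - A"
    then have e: "e > 0"
      using A by simp
    \<comment> \<open>Young's inequality, balanced so that its \<open>\<parallel>G x\<parallel>\<^sup>2\<close> term is the one that the critical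
      condition controls.\<close>
    have "0 \<le> (norm (e *\<^sub>R ?a - ?v))\<^sup>2 / e"
      using e by simp
    also have "\<dots> = e * (norm ?a)\<^sup>2 - 2 * inner ?v ?a + (norm ?v)\<^sup>2 / e"
      using e unfolding power2_norm_eq_inner
      by (simp add: inner_diff_left inner_diff_right inner_commute field_simps)
    finally have "2 * inner ?v ?a \<le> (1 - A) * (norm ?a)\<^sup>2 + (norm ?v)\<^sup>2 / (1 - A)"
      by (simp add: e_def)
    then show "2 * inner ?v ?a - inner ?b ?a \<le> (norm ?v)\<^sup>2 / (1 - A)"
      using critical_condition_inner_bounds(1)[OF crit A] by simp
  qed (use g in simp)
  ultimately show ?thesis
    by (simp add: algebra_simps)
qed

section \<open>The method along one realisation\<close>

text \<open>Summation by parts: every \<open>d k\<close> with \<open>k > 0\<close> occurs with the nonnegative coefficient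
\<open>r k - r (k - 1)\<close>, and \<open>d 0\<close> with \<open>r 0\<close>, so \<open>d k\<close> can be replaced by its bound,
after which the sum telescopes. In the application \<open>r\<close> is the reciprocal of the step size, and this is where the minimum with the previous
step size is used.\<close>

lemma sum_weighted_differences_le:
  fixes r d :: "nat \<Rightarrow> real"
  assumes mono: "\<And>k. r k \<le> r (Suc k)" and r0: "0 \<le> r 0"
    and d: "\<And>k. 0 \<le> d k" "\<And>k. d k \<le> C"
  shows "(\<Sum>k=0..K. r k * (d k - d (Suc k))) \<le> C * r K"
proof -
  have nonneg: "0 \<le> r k" for k
    using mono r0 by (induction k) (auto intro: order.trans)
  have "(\<Sum>k=0..K. r k * (d k - d (Suc k))) \<le> C * r K - r K * d (Suc K)"
  proof (induction K)
    case 0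
    show ?case using mult_left_mono[OF d(2) r0, of 0] by (simp add: algebra_simps)
  next
    case (Suc K)
    have "(r (Suc K) - r K) * d (Suc K) \<le> (r (Suc K) - r K) * C"
      using mono d(2) by (intro mult_left_mono) auto
    then show ?case using Suc by (simp add: algebra_simps)
  qed
  then show ?thesis
    using nonneg d(1) by (smt (verit) mult_nonneg_nonneg)
qed

text \<open>The step size \<open>\<omega>\<^sub>k\<close> itself. The state before iteration \<open>k + 1\<close> is the one that stores it.\<close>

definition dec_polyak_step ::
  "(nat \<Rightarrow> 'a \<Rightarrow> 'a) \<Rightarrow> 'a::real_inner \<Rightarrow> (nat \<Rightarrow> nat set) \<Rightarrow> (nat \<Rightarrow> real) \<Rightarrow> nat \<Rightarrow> ereal"
  where "dec_polyak_step F x0 s g k = snd (dec_polyak_seg_state F x0 s g (Suc k))"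

lemma dec_polyak_seg_Suc:
  "dec_polyak_seg F x0 s g (Suc k) = dec_polyak_seg F x0 s g k
     - real_of_ereal (dec_polyak_step F x0 s g k)
       *\<^sub>R batch_mean F (s k) (dec_polyak_seg_hat F x0 s g k)"
  by (simp add: dec_polyak_seg_def dec_polyak_step_def dec_polyak_seg_hat_def Let_def
      split: prod.split)

lemma dec_polyak_step_0:
  "dec_polyak_step F x0 s g 0
     = polyak_quotient (batch_mean F (s 0)) (dec_polyak_seg F x0 s g 0) (dec_polyak_seg_hat F x0 s g 0)"
  by (simp add: dec_polyak_seg_def dec_polyak_step_def dec_polyak_seg_hat_def Let_def
      flip: top_ereal_def)

lemma dec_polyak_step_Suc:
  "dec_polyak_step F x0 s g (Suc k)
     = min (polyak_quotient (batch_mean F (s (Suc k))) (dec_polyak_seg F x0 s g (Suc k))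
             (dec_polyak_seg_hat F x0 s g (Suc k)))
           (dec_polyak_step F x0 s g k)"
  by (simp add: dec_polyak_seg_def dec_polyak_step_def dec_polyak_seg_hat_def Let_def
      split: prod.split)

lemma dec_polyak_step_le_quotient:
  "dec_polyak_step F x0 s g k
     \<le> polyak_quotient (batch_mean F (s k)) (dec_polyak_seg F x0 s g k) (dec_polyak_seg_hat F x0 s g k)"
  by (cases k) (simp_all add: dec_polyak_step_0 dec_polyak_step_Suc)

lemma polyak_quotient_ge:
  assumes crit: "norm (G xh - G x) \<le> A * norm (G x)" and A: "0 < A" "A < 1"
    and xh: "xh = extrapolate G g x" and g: "0 < g"
  shows "ereal (g / (1 + A)) \<le> polyak_quotient G x xh"
proof (cases "G xh = 0")
  case False
  have "g * (norm (G xh))\<^sup>2 \<le> g * ((1 + A) * inner (G xh) (G x))"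
    using critical_condition_inner_bounds(2)[OF crit A] g by (intro mult_left_mono) auto
  moreover have "inner (G xh) (x - xh) = g * inner (G xh) (G x)"
    by (simp add: xh extrapolate_def)
  ultimately have "g / (1 + A) \<le> inner (G xh) (x - xh) / (norm (G xh))\<^sup>2"
    using False A by (simp add: field_simps)
  then show ?thesis
    using False by (simp add: polyak_quotient_def)
qed (simp add: polyak_quotient_def)

lemma admissible_step_sizes_antimono:
  assumes adm: "admissible_step_sizes F x0 A c s g"
    and c: "\<And>k. 0 < c k" "\<And>k. c k \<le> c (Suc k)"
  shows "g (Suc k) \<le> g k"
proof -
  have "g (Suc k) \<le> c k / c (Suc k) * g k"
    using adm unfolding admissible_step_sizes_def by (metis diff_Suc_1 le_add1 plus_1_eq_Suc)
  also have "\<dots> \<le> 1 * g k"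
    using adm c unfolding admissible_step_sizes_def
    by (intro mult_right_mono) (auto intro: less_imp_le)
  finally show ?thesis by simp
qed

text \<open>The products \<open>c\<^sub>k \<gamma>\<^sub>k\<close> are nonincreasing. This gives a deterministic bound on the random step
sizes, which is used to take \<open>\<gamma>\<^sub>k\<close>, which may depend on the current minibatch, out of the
expectation of the noise.\<close>

lemma admissible_step_sizes_le:
  assumes adm: "admissible_step_sizes F x0 A c s g" and c: "\<And>k. 0 < c k"
  shows "g k \<le> c 0 * g 0 / c k"
proof (induction k)
  case 0
  show ?case
    using c[of 0] by simp
next
  case (Suc k)
  have "g (Suc k) \<le> c k / c (Suc k) * g k"
    using adm unfolding admissible_step_sizes_def by (metis diff_Suc_1 le_add1 plus_1_eq_Suc)
  also have "\<dots> \<le> c k / c (Suc k) * (c 0 * g 0 / c k)"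
    using Suc c[of k] c[of "Suc k"] by (intro mult_left_mono) auto
  also have "\<dots> = c 0 * g 0 / c (Suc k)"
    using c[of k] by simp
  finally show ?case .
qed

text \<open>The step size is the least Polyak quotient so far, the \<open>j\<close>-th of which is at least
\<open>g j / (1 + A)\<close>; as \<open>g\<close> is nonincreasing, the last of these lower bounds is the smallest.\<close>

lemma dec_polyak_step_ge:
  assumes adm: "admissible_step_sizes F x0 A c s g" and A: "0 < A" "A < 1"
    and c: "\<And>k. 0 < c k" "\<And>k. c k \<le> c (Suc k)"
  shows "ereal (g k / (1 + A)) \<le> dec_polyak_step F x0 s g k"
proof (induction k)
  case 0
  show ?case
    unfolding dec_polyak_step_0 using adm A
    by (intro polyak_quotient_ge) (auto simp: admissible_step_sizes_def dec_polyak_seg_hat_def)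
next
  case (Suc k)
  have "ereal (g (Suc k) / (1 + A)) \<le> ereal (g k / (1 + A))"
    using admissible_step_sizes_antimono[OF adm c, of k] A by (simp add: divide_right_mono)
  moreover have "ereal (g (Suc k) / (1 + A)) \<le> polyak_quotient (batch_mean F (s (Suc k)))
      (dec_polyak_seg F x0 s g (Suc k)) (dec_polyak_seg_hat F x0 s g (Suc k))"
    using adm A
    by (intro polyak_quotient_ge) (auto simp: admissible_step_sizes_def dec_polyak_seg_hat_def)
  ultimately show ?case
    unfolding dec_polyak_step_Suc using Suc by (metis min.boundedI order.trans)
qed

text \<open>The convention \<open>inverse 0 = 0\<close> gives the real reciprocal of an infinite step size the right value.\<close>

lemma inverse_real_of_ereal_antimono:
  assumes "0 < a" "a \<le> (b::ereal)"
  shows "inverse (real_of_ereal b) \<le> inverse (real_of_ereal a)"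
  using assms by (cases a; cases b) auto

text \<open>The regret bound along one realisation. Both sides involve the sampled operators at the fixed point
\<open>u\<close>. The steps \<open>\<omega>\<^sub>k\<close>, which depend on the current minibatch, are eliminated here, before any
expectation is taken, so their correlation with the sampled operators does no harm.\<close>

lemma dec_polyak_seg_sum_gap_le:
  fixes F :: "nat \<Rightarrow> 'a \<Rightarrow> 'a::real_inner" and x0 :: 'a
  defines "X \<equiv> dec_polyak_seg F x0"
  assumes adm: "admissible_step_sizes F x0 A c s g"
    and A: "0 < A" "A < 1" and c: "\<And>k. 0 < c k" "\<And>k. c k \<le> c (Suc k)"
    and mono: "\<And>k. monotone_operator (batch_mean F (s k))"
    and D: "\<And>k. (norm (X s g k - u))\<^sup>2 \<le> D\<^sup>2"
  shows "(\<Sum>k=0..K. inner (batch_mean F (s k) u) (X s g k - u))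
    \<le> D\<^sup>2 / g (K + 1)
      + c 0 * g 0 / (2 * (1 - A)) * (\<Sum>k=0..K. (norm (batch_mean F (s k) u))\<^sup>2 / c k)"
proof -
  define w where "w = dec_polyak_step F x0 s g"
  define r where "r k = inverse (real_of_ereal (w k))" for k
  define d where "d k = (norm (X s g k - u))\<^sup>2" for k
  let ?G = "\<lambda>k. batch_mean F (s k)"
  have g: "0 < g k" for k
    using adm by (simp add: admissible_step_sizes_def)
  have wge: "ereal (g k / (1 + A)) \<le> w k" for k
    unfolding w_def by (rule dec_polyak_step_ge[OF adm A c])
  have gA: "0 < ereal (g k / (1 + A))" for k
    using g A by simp
  have wpos: "0 < w k" for k
    using gA wge by (rule order.strict_trans2)
  have "r k \<le> r (Suc k)" for k
    unfolding r_def
    by (rule inverse_real_of_ereal_antimono[OF wpos]) (simp add: w_def dec_polyak_step_Suc)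
  moreover have "0 \<le> r 0"
    unfolding r_def using wpos[of 0] by (simp add: real_of_ereal_pos order.strict_implies_order)
  ultimately have telescope: "(\<Sum>k=0..K. r k * (d k - d (Suc k))) \<le> D\<^sup>2 * r K"
    using D by (intro sum_weighted_differences_le) (auto simp: d_def)
  have "r K \<le> (1 + A) / g K"
    using inverse_real_of_ereal_antimono[OF gA wge, of K] by (simp add: r_def)
  also have "\<dots> \<le> 2 / g (K + 1)"
    using A g admissible_step_sizes_antimono[OF adm c, of K] by (intro frac_le) auto
  finally have last: "D\<^sup>2 * r K \<le> D\<^sup>2 * (2 / g (K + 1))"
    by (intro mult_left_mono) auto
  have "2 * inner (?G k u) (X s g k - u)
      \<le> r k * (d k - d (Suc k)) + c 0 * g 0 / (1 - A) * ((norm (?G k u))\<^sup>2 / c k)" for k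
  proof -
    let ?xh = "dec_polyak_seg_hat F x0 s g k"
    have "2 * inner (?G k u) (X s g k - u)
        \<le> r k * ((norm (X s g k - u))\<^sup>2 - (norm (X s g k - real_of_ereal (w k) *\<^sub>R ?G k ?xh - u))\<^sup>2)
          + g k * (norm (?G k u))\<^sup>2 / (1 - A)"
      unfolding r_def
    proof (rule polyak_step_gap_le[OF mono g A])
      show "?xh = extrapolate (?G k) (g k) (X s g k)"
        by (simp add: dec_polyak_seg_hat_def X_def)
      show "norm (?G k ?xh - ?G k (X s g k)) \<le> A * norm (?G k (X s g k))"
        using adm by (simp add: admissible_step_sizes_def X_def)
      assume nz: "?G k ?xh \<noteq> 0"
      then have le: "w k \<le> ereal (inner (?G k ?xh) (X s g k - ?xh) / (norm (?G k ?xh))\<^sup>2)"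
        using dec_polyak_step_le_quotient[of F x0 s g k]
        by (simp add: w_def X_def polyak_quotient_def)
      then obtain v where v: "w k = ereal v"
        using wpos[of k] by (cases "w k") auto
      then show "0 < real_of_ereal (w k) \<and>
          real_of_ereal (w k) * (norm (?G k ?xh))\<^sup>2 \<le> inner (?G k ?xh) (X s g k - ?xh)"
        using le wpos[of k] nz by (simp add: field_simps)
    qed
    also have "X s g k - real_of_ereal (w k) *\<^sub>R ?G k ?xh = X s g (Suc k)"
      by (simp add: X_def w_def dec_polyak_seg_Suc)
    also have "g k * (norm (?G k u))\<^sup>2 / (1 - A)
        \<le> (c 0 * g 0 / c k) * (norm (?G k u))\<^sup>2 / (1 - A)"
      using admissible_step_sizes_le[OF adm c(1)] A
      by (intro divide_right_mono mult_right_mono) auto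
    finally show ?thesis
      by (simp add: d_def mult_ac)
  qed
  then have "(\<Sum>k=0..K. 2 * inner (?G k u) (X s g k - u))
      \<le> (\<Sum>k=0..K. r k * (d k - d (Suc k)))
        + c 0 * g 0 / (1 - A) * (\<Sum>k=0..K. (norm (?G k u))\<^sup>2 / c k)"
    by (simp add: sum_distrib_left sum_mono flip: sum.distrib)
  then have "2 * (\<Sum>k=0..K. inner (?G k u) (X s g k - u))
      \<le> 2 * (D\<^sup>2 / g (K + 1))
        + c 0 * g 0 / (1 - A) * (\<Sum>k=0..K. (norm (?G k u))\<^sup>2 / c k)"
    using telescope last by (simp add: mult.commute flip: sum_distrib_left)
  moreover have "t \<le> a + c 0 * g 0 / (2 * (1 - A)) * q"
    if "2 * t \<le> 2 * a + c 0 * g 0 / (1 - A) * q" for t a q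
    using that A by (simp add: divide_simps) (simp add: algebra_simps)
  ultimately show ?thesis
    by blast
qed

section \<open>Random variables determined by past samples\<close>

text \<open>For samples in a finite set this is measurability with respect to the first \<open>k\<close> samples, those
strictly before time \<open>k\<close>. Stated pointwise, it transfers to any function of \<open>Z\<close> without a
measurability proof.\<close>

definition past_determined ::
  "'w measure \<Rightarrow> (nat \<Rightarrow> 'w \<Rightarrow> 's) \<Rightarrow> nat \<Rightarrow> ('w \<Rightarrow> 'b) \<Rightarrow> bool" where
  "past_determined M S k Z \<longleftrightarrow>
     (\<forall>\<omega>\<in>space M. \<forall>\<omega>'\<in>space M. (\<forall>j<k. S j \<omega> = S j \<omega>') \<longrightarrow> Z \<omega> = Z \<omega>')"

lemma past_determined_current: "past_determined M S (Suc k) (S k)"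
  unfolding past_determined_def by blast

lemma past_determined_compose:
  "past_determined M S k Z \<Longrightarrow> past_determined M S k (\<lambda>\<omega>. f (Z \<omega>))"
  unfolding past_determined_def by metis

lemma past_determined_compose2:
  "past_determined M S k Y \<Longrightarrow> past_determined M S k Z
    \<Longrightarrow> past_determined M S k (\<lambda>\<omega>. f (Y \<omega>) (Z \<omega>))"
  unfolding past_determined_def by metis

lemma past_determined_Suc:
  "past_determined M S k Z \<Longrightarrow> past_determined M S (Suc k) Z"
  unfolding past_determined_def by (meson less_SucI)

lemma past_determined_factors:
  assumes "past_determined M S k Z"
  obtains f where "\<And>\<omega>. \<omega> \<in> space M \<Longrightarrow> Z \<omega> = f (\<lambda>j\<in>{..<k}. S j \<omega>)"
proof -
  define f where
    "f t = Z (SOME \<omega>. \<omega> \<in> space M \<and> (\<lambda>j\<in>{..<k}. S j \<omega>) = t)" for t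
  have "Z \<omega> = f (\<lambda>j\<in>{..<k}. S j \<omega>)" if \<omega>: "\<omega> \<in> space M" for \<omega>
  proof -
    define \<omega>' where "\<omega>' = (SOME \<omega>'. \<omega>' \<in> space M \<and> (\<lambda>j\<in>{..<k}. S j \<omega>') = (\<lambda>j\<in>{..<k}. S j \<omega>))"
    have \<omega>': "\<omega>' \<in> space M \<and> (\<lambda>j\<in>{..<k}. S j \<omega>') = (\<lambda>j\<in>{..<k}. S j \<omega>)"
      unfolding \<omega>'_def by (rule someI[of _ \<omega>]) (rule conjI[OF \<omega> refl])
    have "S j \<omega> = S j \<omega>'" if "j < k" for j
      using fun_cong[OF conjunct2[OF \<omega>'], of j] that by simp
    then have "Z \<omega> = Z \<omega>'"
      using assms \<omega> \<omega>' unfolding past_determined_def by blast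
    then show ?thesis
      unfolding f_def \<omega>'_def .
  qed
  then show thesis by (rule that)
qed

lemma measurable_PiM_finite_count_space:
  assumes "finite I" "finite A"
  shows "f \<in> measurable (PiM I (\<lambda>_. count_space A)) N \<longleftrightarrow> f \<in> PiE I (\<lambda>_. A) \<rightarrow> space N"
  using assms by (simp add: count_space_PiM_finite countable_finite measurable_count_space_eq1)

text \<open>The history \<open>(S 0, \<dots>, S (k - 1))\<close> takes finitely many values, each on a measurable event, so \<open>Z\<close>
is a simple function.\<close>

lemma (in prob_space) past_determined_integrable:
  fixes Z :: "'a \<Rightarrow> 'b::{banach, second_countable_topology}"
  assumes S: "\<And>j. S j \<in> measurable M (count_space A)" and A: "finite A"
    and Z: "past_determined M S k Z"
  shows "integrable M Z"
proof -
  obtain f where f: "\<And>\<omega>. \<omega> \<in> space M \<Longrightarrow> Z \<omega> = f (\<lambda>j\<in>{..<k}. S j \<omega>)"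
    using past_determined_factors[OF Z] by blast
  let ?T = "\<lambda>\<omega>. \<lambda>j\<in>{..<k}. S j \<omega>" and ?Q = "PiM {..<k} (\<lambda>_. count_space A)"
  have T: "?T \<in> measurable M ?Q"
    using S by (intro measurable_restrict)
  have fm: "f \<in> borel_measurable ?Q"
    using A by (simp add: measurable_PiM_finite_count_space)
  have fin: "finite (PiE {..<k} (\<lambda>_. A))"
    using A by (intro finite_PiE) auto
  have "integrable M (\<lambda>\<omega>. f (?T \<omega>))"
  proof (rule integrable_const_bound)
    show "(\<lambda>\<omega>. f (?T \<omega>)) \<in> borel_measurable M"
      using measurable_comp[OF T fm] by (simp add: o_def)
    show "AE \<omega> in M. norm (f (?T \<omega>)) \<le> (\<Sum>t\<in>PiE {..<k} (\<lambda>_. A). norm (f t))"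
    proof (rule AE_I2)
      fix \<omega> assume "\<omega> \<in> space M"
      then have "?T \<omega> \<in> PiE {..<k} (\<lambda>_. A)"
        using measurable_space[OF S] by auto
      then show "norm (f (?T \<omega>)) \<le> (\<Sum>t\<in>PiE {..<k} (\<lambda>_. A). norm (f t))"
        by (rule member_le_sum[where f = "\<lambda>t. norm (f t)"]) (use fin in simp_all)
    qed
  qed
  then show ?thesis
    by (subst Bochner_Integration.integrable_cong[OF refl f])
qed

text \<open>The sample at time \<open>k\<close> is independent of the history, hence every coordinate of \<open>h (S k)\<close> is
independent of the same coordinate of \<open>Z\<close>.\<close>

lemma (in prob_space) expectation_inner_past:
  fixes Z :: "'a \<Rightarrow> 'b::euclidean_space"
  assumes indep: "indep_vars (\<lambda>_. count_space A) S UNIV" and A: "finite A"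
    and Z: "past_determined M S k Z"
  shows "expectation (\<lambda>\<omega>. inner (h (S k \<omega>)) (Z \<omega>))
    = inner (expectation (\<lambda>\<omega>. h (S k \<omega>))) (expectation Z)"
proof -
  have S: "S j \<in> measurable M (count_space A)" for j
    using indep by (simp add: indep_vars_def)
  obtain f where f: "\<And>\<omega>. \<omega> \<in> space M \<Longrightarrow> Z \<omega> = f (\<lambda>j\<in>{..<k}. S j \<omega>)"
    using past_determined_factors[OF Z] by blast
  let ?T = "\<lambda>\<omega>. \<lambda>j\<in>{..<k}. S j \<omega>"
  let ?U = "\<lambda>\<omega>. \<lambda>j\<in>{k}. S j \<omega>"
  have hint: "integrable M (\<lambda>\<omega>. h (S k \<omega>))"
    by (rule past_determined_integrable[OF S A past_determined_compose[OF past_determined_current]])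
  have fint: "integrable M (\<lambda>\<omega>. f (?T \<omega>))"
    by (rule iffD1[OF Bochner_Integration.integrable_cong[OF refl f]
          past_determined_integrable[OF S A Z]])
  have "indep_var (PiM {k} (\<lambda>_. count_space A)) ?U (PiM {..<k} (\<lambda>_. count_space A)) ?T"
    by (rule indep_var_restrict[OF indep]) auto
  then have "indep_var borel ((\<lambda>t. inner (h (t k)) b) \<circ> ?U) borel ((\<lambda>t. inner (f t) b) \<circ> ?T)" for b
    by (rule indep_var_compose) (use A in \<open>simp_all add: measurable_PiM_finite_count_space\<close>)
  then have ind: "indep_var borel (\<lambda>\<omega>. inner (h (S k \<omega>)) b) borel (\<lambda>\<omega>. inner (f (?T \<omega>)) b)" for b
    by (simp add: o_def)
  have "expectation (\<lambda>\<omega>. inner (h (S k \<omega>)) (Z \<omega>))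
      = expectation (\<lambda>\<omega>. \<Sum>b\<in>Basis. inner (h (S k \<omega>)) b * inner (f (?T \<omega>)) b)"
    by (intro Bochner_Integration.integral_cong refl) (simp only: f euclidean_inner[symmetric])
  also have "\<dots> = (\<Sum>b\<in>Basis. expectation (\<lambda>\<omega>. inner (h (S k \<omega>)) b * inner (f (?T \<omega>)) b))"
    by (intro Bochner_Integration.integral_sum indep_var_integrable[OF ind] integrable_inner_left
        hint fint)
  also have "\<dots> = (\<Sum>b\<in>Basis. expectation (\<lambda>\<omega>. inner (h (S k \<omega>)) b)
      * expectation (\<lambda>\<omega>. inner (f (?T \<omega>)) b))"
    by (intro sum.cong refl indep_var_lebesgue_integral[OF ind] integrable_inner_left hint fint)
  also have "\<dots> = (\<Sum>b\<in>Basis. inner (expectation (\<lambda>\<omega>. h (S k \<omega>))) b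
      * inner (expectation (\<lambda>\<omega>. f (?T \<omega>))) b)"
    using hint fint by simp
  also have "\<dots> = inner (expectation (\<lambda>\<omega>. h (S k \<omega>))) (expectation (\<lambda>\<omega>. f (?T \<omega>)))"
    by (rule euclidean_inner[symmetric])
  also have "expectation (\<lambda>\<omega>. f (?T \<omega>)) = expectation Z"
    by (intro Bochner_Integration.integral_cong refl) (simp only: f)
  finally show ?thesis .
qed

lemma integral_of_pmf_law:
  fixes h :: "'s \<Rightarrow> 'b::{banach, second_countable_topology}"
  assumes "X \<in> measurable M (count_space UNIV)"
    and "distr M (count_space UNIV) X = measure_pmf P"
  shows "(\<integral>\<omega>. h (X \<omega>) \<partial>M) = measure_pmf.expectation P h"
  using integral_distr[OF assms(1), of h] by (simp add: assms(2))

section \<open>The bound in expectation\<close>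

lemma monotone_batch_mean:
  assumes "\<And>i. i \<in> s \<Longrightarrow> monotone_operator (F i)"
  shows "monotone_operator (batch_mean F s)"
  using assms unfolding monotone_operator_def batch_mean_def
  by (auto simp flip: scaleR_diff_right sum_subtractf simp: inner_sum_left
      intro!: sum_nonneg divide_nonneg_nonneg)

lemma lipschitz_batch_mean:
  fixes F :: "nat \<Rightarrow> 'a::real_normed_vector \<Rightarrow> 'a"
  assumes "\<And>i. i \<in> s \<Longrightarrow> L-lipschitz_on UNIV (F i)" and s: "finite s" "s \<noteq> {}"
  shows "L-lipschitz_on UNIV (batch_mean F s)"
proof (rule lipschitz_onI)
  fix y z :: 'a
  have "norm (\<Sum>i\<in>s. F i y - F i z) \<le> (\<Sum>i\<in>s. L * norm (y - z))"
    using lipschitz_onD[OF assms(1), of _ y z] by (intro sum_norm_le) (simp add: dist_norm)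
  then have "norm (\<Sum>i\<in>s. F i y - F i z) / real (card s) \<le> L * norm (y - z)"
    using s by (simp add: field_simps card_gt_0_iff)
  then show "dist (batch_mean F s y) (batch_mean F s z) \<le> L * dist y z"
    by (simp add: dist_norm batch_mean_def sum_subtractf flip: scaleR_diff_right)
qed (use assms in \<open>auto intro: lipschitz_on_nonneg\<close>)

lemma dec_polyak_seg_state_cong:
  assumes "\<And>j. j < k \<Longrightarrow> s j = s' j" "\<And>j. j < k \<Longrightarrow> g j = g' j"
  shows "dec_polyak_seg_state F x0 s g k = dec_polyak_seg_state F x0 s' g' k"
  using assms by (induction k) simp_all

text \<open>The inequality \<open>(p + q)\<^sup>2 \<le> 2 p\<^sup>2 + 2 q\<^sup>2\<close> is where the factors \<open>2\<close> in the variance constant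
come from; \<open>v\<close> will be the zero of the full operator.\<close>

lemma lipschitz_norm_square_le:
  fixes G :: "'a::real_normed_vector \<Rightarrow> 'b::real_normed_vector"
  assumes "L-lipschitz_on UNIV G"
  shows "(norm (G u))\<^sup>2 \<le> 2 * L\<^sup>2 * (norm (u - v))\<^sup>2 + 2 * (norm (G v))\<^sup>2"
proof -
  have "norm (G u) \<le> norm (G u - G v) + norm (G v)"
    using norm_triangle_ineq[of "G u - G v" "G v"] by simp
  also have "\<dots> \<le> L * norm (u - v) + norm (G v)"
    using lipschitz_onD[OF assms, of u v] by (simp add: dist_norm)
  finally have "(norm (G u))\<^sup>2 \<le> (L * norm (u - v) + norm (G v))\<^sup>2"
    by (intro power_mono) auto
  also have "\<dots> \<le> 2 * (L * norm (u - v))\<^sup>2 + 2 * (norm (G v))\<^sup>2"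
    using sum_squares_bound[of "L * norm (u - v)" "norm (G v)"] by (simp add: power2_sum)
  finally show ?thesis by (simp add: power_mult_distrib)
qed

theorem theorem3p4:
  fixes F :: "nat \<Rightarrow> real ^ 'd \<Rightarrow> real ^ 'd"
    and M :: "'w measure"
    and P :: "nat set pmf"
    and S :: "nat \<Rightarrow> 'w \<Rightarrow> nat set"
    and \<gamma> :: "nat \<Rightarrow> 'w \<Rightarrow> real"
    and x xh :: "nat \<Rightarrow> 'w \<Rightarrow> real ^ 'd"
    and \<C> :: "(real ^ 'd) set"
    and x0 xs u :: "real ^ 'd"
    and n B K :: nat
    and L A D \<gamma>0 \<sigma>2 :: real
  assumes "1 \<le> B" and "B \<le> n"
    and lipschitz: "\<And>i. i \<in> {1..n} \<Longrightarrow> L-lipschitz_on UNIV (F i)"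
    and monotone: "\<And>i. i \<in> {1..n} \<Longrightarrow> monotone_operator (F i)"
    and "prob_space M"
    and independent: "prob_space.indep_vars M (\<lambda>_. count_space (minibatches n B)) S UNIV"
    and law: "\<And>k. distr M (count_space UNIV) (S k) = measure_pmf P"
    and unbiased: "\<And>y. measure_pmf.expectation P (\<lambda>s. batch_mean F s y) = batch_mean F {1..n} y"
    and nonanticipating: "\<And>k \<omega> \<omega>'. \<omega> \<in> space M \<Longrightarrow> \<omega>' \<in> space M \<Longrightarrow>
        (\<And>j. j \<le> k \<Longrightarrow> S j \<omega> = S j \<omega>') \<Longrightarrow> \<gamma> k \<omega> = \<gamma> k \<omega>'"
    and initial_step: "\<And>\<omega>. \<omega> \<in> space M \<Longrightarrow> \<gamma> 0 \<omega> = \<gamma>0"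
    and iterates: "\<And>k \<omega>. x k \<omega> = dec_polyak_seg F x0 (\<lambda>j. S j \<omega>) (\<lambda>j. \<gamma> j \<omega>) k"
    and extrapolated: "\<And>k \<omega>. xh k \<omega> = dec_polyak_seg_hat F x0 (\<lambda>j. S j \<omega>) (\<lambda>j. \<gamma> j \<omega>) k"
    and "0 < A" and "A < 1"
    and admissible: "AE \<omega> in M. admissible_step_sizes F x0 A (\<lambda>k. sqrt (real k + 1))
        (\<lambda>j. S j \<omega>) (\<lambda>j. \<gamma> j \<omega>)"
    and "compact \<C>"
    and "xs \<in> \<C>" and "batch_mean F {1..n} xs = 0"
    and confined: "AE \<omega> in M. \<forall>k\<ge>1. x k \<omega> \<in> \<C> \<and> xh k \<omega> \<in> \<C>"
    and distance: "AE \<omega> in M. \<forall>k. \<forall>v\<in>\<C>. (norm (x k \<omega> - v))\<^sup>2 \<le> D\<^sup>2"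
    and variance: "\<sigma>2 = 2 * L\<^sup>2 * (SUP (u1, u2)\<in>\<C> \<times> \<C>. (norm (u1 - u2))\<^sup>2)
        + 2 * measure_pmf.expectation P (\<lambda>s. (norm (batch_mean F s xs))\<^sup>2)"
    and "u \<in> \<C>"
  shows "prob_space.expectation M (\<lambda>\<omega>. inner (batch_mean F {1..n} u)
             ((1 / (real K + 1)) *\<^sub>R (\<Sum>k=0..K. x k \<omega>) - u))
         \<le> 1 / (real K + 1) * prob_space.expectation M (\<lambda>\<omega>. D\<^sup>2 / \<gamma> (K + 1) \<omega>)
           + \<sigma>2 * \<gamma>0 / ((1 - A) * (real K + 1)) * (\<Sum>k=0..K. 1 / sqrt (real k + 1))"
proof -
  interpret prob_space M by fact
  define \<A> where "\<A> = minibatches n B"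
  let ?G = "\<lambda>k \<omega>. batch_mean F (S k \<omega>)"
  have fin: "finite \<A>"
    unfolding \<A>_def minibatches_def by (rule finite_subset[of _ "Pow {1..n}"]) auto
  have indep: "indep_vars (\<lambda>_. count_space \<A>) S UNIV"
    unfolding \<A>_def by (rule independent)
  have S: "S k \<in> measurable M (count_space \<A>)" for k
    using indep by (simp add: indep_vars_def)
  then have SA: "S k \<omega> \<in> \<A>" if "\<omega> \<in> space M" for k \<omega>
    using measurable_space[OF S that] by simp
  have S_UNIV: "S k \<in> measurable M (count_space UNIV)" for k
    using measurable_compose[OF S[of k] measurable_count_space] .
  have batch: "s \<subseteq> {1..n}" "finite s" "s \<noteq> {}" if "s \<in> \<A>" for s
    using that \<open>1 \<le> B\<close> by (auto simp: \<A>_def minibatches_def intro: finite_subset)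
  note law_integral = integral_of_pmf_law[OF S_UNIV law]

  have past_\<gamma>: "past_determined M S (Suc k) (\<gamma> k)" for k
    unfolding past_determined_def less_Suc_eq_le using nonanticipating[of _ _ k] by blast
  have past_x: "past_determined M S k (x k)" for k
    unfolding past_determined_def iterates dec_polyak_seg_def
  proof (intro ballI impI arg_cong[where f = fst] dec_polyak_seg_state_cong)
    fix \<omega> \<omega>' j assume "\<omega> \<in> space M" "\<omega>' \<in> space M" "\<forall>i<k. S i \<omega> = S i \<omega>'" "j < k"
    then show "\<gamma> j \<omega> = \<gamma> j \<omega>'"
      by (intro nonanticipating) auto
  qed auto
  note integrable_past = past_determined_integrable[OF S fin]
  have int_x: "integrable M (\<lambda>\<omega>. x k \<omega>)" for k
    using integrable_past[OF past_x] .
  have int_gap: "integrable M (\<lambda>\<omega>. inner (?G k \<omega> u) (x k \<omega> - u))" for k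
    by (rule integrable_past[OF past_determined_compose2[OF past_determined_current
            past_determined_Suc[OF past_x], where f = "\<lambda>s z. inner (batch_mean F s u) (z - u)"]])
  have int_noise: "integrable M (\<lambda>\<omega>. h (S k \<omega>))" for k and h :: "nat set \<Rightarrow> real"
    by (rule integrable_past[OF past_determined_compose[OF past_determined_current]])
  have int_\<gamma>: "integrable M (\<lambda>\<omega>. D\<^sup>2 / \<gamma> k \<omega>)" for k
    by (rule integrable_past[OF past_determined_compose[OF past_\<gamma>]])

  \<comment> \<open>The sampled operator at the fixed point \<open>u\<close> is independent of \<open>x\<^sub>k\<close>.\<close>
  have gap: "expectation (\<lambda>\<omega>. inner (batch_mean F {1..n} u) (x k \<omega> - u))
      = expectation (\<lambda>\<omega>. inner (?G k \<omega> u) (x k \<omega> - u))" for k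
  proof -
    have "past_determined M S k (\<lambda>\<omega>. x k \<omega> - u)"
      by (rule past_determined_compose[OF past_x])
    from expectation_inner_past[OF indep fin this, of "\<lambda>s. batch_mean F s u"]
    show ?thesis
      using int_x[of k] by (simp add: law_integral[of "\<lambda>s. batch_mean F s u"] unbiased)
  qed

  have noise: "expectation (\<lambda>\<omega>. (norm (?G k \<omega> u))\<^sup>2) \<le> \<sigma>2" for k
  proof -
    let ?R = "\<lambda>(u1, u2). (norm (u1 - u2 :: real ^ 'd))\<^sup>2"
    have "compact (?R ` (\<C> \<times> \<C>))"
      using \<open>compact \<C>\<close> unfolding case_prod_beta
      by (intro compact_continuous_image compact_Times continuous_intros)
    then have "bdd_above (?R ` (\<C> \<times> \<C>))"
      by (intro bounded_imp_bdd_above compact_imp_bounded)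
    then have sup: "(norm (u - xs))\<^sup>2 \<le> (SUP p\<in>\<C> \<times> \<C>. ?R p)"
      using \<open>u \<in> \<C>\<close> \<open>xs \<in> \<C>\<close> by (intro cSUP_upper2[where x = "(u, xs)"]) auto
    have "expectation (\<lambda>\<omega>. (norm (?G k \<omega> u))\<^sup>2)
        \<le> expectation (\<lambda>\<omega>. 2 * L\<^sup>2 * (norm (u - xs))\<^sup>2 + 2 * (norm (?G k \<omega> xs))\<^sup>2)"
    proof (rule integral_mono)
      fix \<omega> assume "\<omega> \<in> space M"
      then have "L-lipschitz_on UNIV (?G k \<omega>)"
        using SA[of \<omega> k] batch[of "S k \<omega>"] by (intro lipschitz_batch_mean lipschitz) auto
      then show "(norm (?G k \<omega> u))\<^sup>2 \<le> 2 * L\<^sup>2 * (norm (u - xs))\<^sup>2 + 2 * (norm (?G k \<omega> xs))\<^sup>2"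
        by (rule lipschitz_norm_square_le)
    qed (intro int_noise[of "\<lambda>s. (norm (batch_mean F s u))\<^sup>2"]
        int_noise[of "\<lambda>s. 2 * L\<^sup>2 * (norm (u - xs))\<^sup>2 + 2 * (norm (batch_mean F s xs))\<^sup>2"])+
    also have "\<dots> = 2 * L\<^sup>2 * (norm (u - xs))\<^sup>2
        + 2 * measure_pmf.expectation P (\<lambda>s. (norm (batch_mean F s xs))\<^sup>2)"
      using int_noise[of "\<lambda>s. (norm (batch_mean F s xs))\<^sup>2" k]
      by (simp add: law_integral[of "\<lambda>s. (norm (batch_mean F s xs))\<^sup>2"] prob_space)
    also have "\<dots> \<le> \<sigma>2"
      unfolding variance using sup by (intro add_right_mono mult_left_mono) auto
    finally show ?thesis .
  qed
  have "0 \<le> expectation (\<lambda>\<omega>. (norm (?G 0 \<omega> u))\<^sup>2)"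
    by simp
  then have \<sigma>2: "0 \<le> \<sigma>2"
    using noise[of 0] by linarith

  define Q where "Q \<omega> = (\<Sum>k=0..K. (norm (?G k \<omega> u))\<^sup>2 / sqrt (real k + 1))" for \<omega>
  have int_Q: "integrable M Q"
    unfolding Q_def by (intro Bochner_Integration.integrable_sum
        int_noise[of "\<lambda>s. (norm (batch_mean F s u))\<^sup>2 / sqrt (real _ + 1)"])
  have "expectation Q = (\<Sum>k=0..K. expectation (\<lambda>\<omega>. (norm (?G k \<omega> u))\<^sup>2) / sqrt (real k + 1))"
    unfolding Q_def using int_noise[of "\<lambda>s. (norm (batch_mean F s u))\<^sup>2"] by simp
  also have "\<dots> \<le> (\<Sum>k=0..K. \<sigma>2 / sqrt (real k + 1))"
    by (intro sum_mono divide_right_mono noise) auto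
  also have "\<dots> = \<sigma>2 * (\<Sum>k=0..K. 1 / sqrt (real k + 1))"
    by (simp add: sum_distrib_left)
  finally have EQ: "expectation Q \<le> \<sigma>2 * (\<Sum>k=0..K. 1 / sqrt (real k + 1))" .

  \<comment> \<open>On a probability space an almost sure statement without randomness is true.\<close>
  have "AE \<omega> in M. 0 < \<gamma>0"
    using admissible AE_space
  proof eventually_elim
    case (elim \<omega>)
    then have "0 < \<gamma> 0 \<omega>"
      unfolding admissible_step_sizes_def by blast
    then show ?case
      by (simp only: initial_step[OF elim(2)])
  qed
  then have \<gamma>0: "0 < \<gamma>0"
    by simp
  have path: "AE \<omega> in M. (\<Sum>k=0..K. inner (?G k \<omega> u) (x k \<omega> - u))
      \<le> D\<^sup>2 / \<gamma> (K + 1) \<omega> + \<gamma>0 / (2 * (1 - A)) * Q \<omega>"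
    using admissible distance AE_space
  proof eventually_elim
    case (elim \<omega>)
    have "monotone_operator (?G k \<omega>)" for k
      using SA[OF elim(3), of k] batch[of "S k \<omega>"] by (intro monotone_batch_mean monotone) auto
    moreover have "(norm (x k \<omega> - u))\<^sup>2 \<le> D\<^sup>2" for k
      using elim(2) \<open>u \<in> \<C>\<close> by blast
    ultimately show ?case
      using dec_polyak_seg_sum_gap_le[OF elim(1) \<open>0 < A\<close> \<open>A < 1\<close>, of u D K] initial_step[OF elim(3)]
      by (simp add: iterates Q_def)
  qed

  have "(\<Sum>k=0..K. expectation (\<lambda>\<omega>. inner (?G k \<omega> u) (x k \<omega> - u)))
      = expectation (\<lambda>\<omega>. \<Sum>k=0..K. inner (?G k \<omega> u) (x k \<omega> - u))"
    using int_gap by simp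
  also have "\<dots> \<le> expectation (\<lambda>\<omega>. D\<^sup>2 / \<gamma> (K + 1) \<omega> + \<gamma>0 / (2 * (1 - A)) * Q \<omega>)"
    by (rule integral_mono_AE) (use path int_gap int_\<gamma> int_Q in auto)
  also have "\<dots> = expectation (\<lambda>\<omega>. D\<^sup>2 / \<gamma> (K + 1) \<omega>) + \<gamma>0 / (2 * (1 - A)) * expectation Q"
    using int_\<gamma>[of "K + 1"] int_Q by simp
  also have "\<gamma>0 / (2 * (1 - A)) * expectation Q
      \<le> \<gamma>0 / (1 - A) * (\<sigma>2 * (\<Sum>k=0..K. 1 / sqrt (real k + 1)))"
  proof (rule order.trans[OF mult_left_mono[OF EQ] mult_right_mono])
    show "\<gamma>0 / (2 * (1 - A)) \<le> \<gamma>0 / (1 - A)"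
      using \<gamma>0 \<open>A < 1\<close> by (intro divide_left_mono) auto
  qed (use \<gamma>0 \<sigma>2 \<open>A < 1\<close> in \<open>auto intro!: mult_nonneg_nonneg sum_nonneg\<close>)
  finally have total: "(\<Sum>k=0..K. expectation (\<lambda>\<omega>. inner (?G k \<omega> u) (x k \<omega> - u)))
      \<le> expectation (\<lambda>\<omega>. D\<^sup>2 / \<gamma> (K + 1) \<omega>)
        + \<gamma>0 / (1 - A) * (\<sigma>2 * (\<Sum>k=0..K. 1 / sqrt (real k + 1)))"
    by simp

  have avg: "(1 / (real K + 1)) *\<^sub>R (\<Sum>k=0..K. x k \<omega>) - u
      = (1 / (real K + 1)) *\<^sub>R (\<Sum>k=0..K. x k \<omega> - u)" for \<omega>
  proof -
    have "(\<Sum>k=0..K. u) = (real K + 1) *\<^sub>R u"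
      by (simp only: sum_constant_scaleR) simp
    then show ?thesis
      by (simp only: sum_subtractf scaleR_diff_right scaleR_scaleR) simp
  qed
  have "expectation (\<lambda>\<omega>. inner (batch_mean F {1..n} u)
        ((1 / (real K + 1)) *\<^sub>R (\<Sum>k=0..K. x k \<omega>) - u))
      = 1 / (real K + 1) * (\<Sum>k=0..K. expectation (\<lambda>\<omega>. inner (batch_mean F {1..n} u) (x k \<omega> - u)))"
    unfolding avg using int_x by (simp add: inner_sum_right)
  also have "\<dots> \<le> 1 / (real K + 1) * (expectation (\<lambda>\<omega>. D\<^sup>2 / \<gamma> (K + 1) \<omega>)
      + \<gamma>0 / (1 - A) * (\<sigma>2 * (\<Sum>k=0..K. 1 / sqrt (real k + 1))))"
    unfolding gap by (intro mult_left_mono total) auto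
  finally show ?thesis
    by (simp add: algebra_simps)
qed

end
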